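(* Let $G$ be a (finite, simple, undirected) threshold graph. Then $\tau(G) \leq 2\mu(G)$.
   Context: A triangle packing of a graph $G$ is a family of pairwise edge-disjoint triangles of $G$; $\mu(G)$ denotes the maximum size of a triangle packing in $G$. A triangle hitting of $G$ is a set of edges intersecting every triangle of $G$; $\tau(G)$ denotes the minimum size of a triangle hitting in $G$. For a vertex $v$, $N(v)$ is its neighbourhood and $N[v]=N(v)\cup\{v\}$ its closed neighbourhood. A graph $G$ is a threshold graph if its vertex set can be partitioned into sets $K=\{c_1,\dots,c_k\}$ and $S=\{u_1,\dots,u_s\}$ such that $G[K]$ is a clique, $G[S]$ is an independent set, $N[c_{i+1}]\subseteq N[c_i]$ for all $1\le i<k$, and $N(u_i)\subseteq N(u_{i+1})$ for all $1\le i<s$. *)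

theory Defs
  imports "HOL-Library.Ramsey"
begin

definition fin_sgraph :: "'a set \<Rightarrow> 'a set set \<Rightarrow> bool" where
  "fin_sgraph V E \<longleftrightarrow> finite V \<and> E \<subseteq> [V]\<^bsup>2\<^esup>"

definition neighbourhood :: "'a set set \<Rightarrow> 'a \<Rightarrow> 'a set" where
  "neighbourhood E v = {w. {v, w} \<in> E}"

definition closed_neighbourhood :: "'a set set \<Rightarrow> 'a \<Rightarrow> 'a set" where
  "closed_neighbourhood E v = insert v (neighbourhood E v)"

text \<open>Triangles are given by their vertex sets; the edge set of a triangle \<open>T\<close> is \<open>[T]\<^bsup>2\<^esup>\<close>.\<close>

definition triangles :: "'a set \<Rightarrow> 'a set set \<Rightarrow> 'a set set" where
  "triangles V E = {T \<in> [V]\<^bsup>3\<^esup>. clique T E}"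

definition triangle_packing :: "'a set \<Rightarrow> 'a set set \<Rightarrow> 'a set set \<Rightarrow> bool" where
  "triangle_packing V E P \<longleftrightarrow>
     P \<subseteq> triangles V E \<and> pairwise (\<lambda>T T'. disjnt ([T]\<^bsup>2\<^esup>) ([T']\<^bsup>2\<^esup>)) P"

definition triangle_hitting :: "'a set \<Rightarrow> 'a set set \<Rightarrow> 'a set set \<Rightarrow> bool" where
  "triangle_hitting V E H \<longleftrightarrow> H \<subseteq> E \<and> (\<forall>T \<in> triangles V E. H \<inter> [T]\<^bsup>2\<^esup> \<noteq> {})"

definition packing_number :: "'a set \<Rightarrow> 'a set set \<Rightarrow> nat" where
  "packing_number V E = Max (card ` {P. triangle_packing V E P})"

definition hitting_number :: "'a set \<Rightarrow> 'a set set \<Rightarrow> nat" where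
  "hitting_number V E = Min (card ` {H. triangle_hitting V E H})"

text \<open>The maximum and minimum above are taken over finite nonempty sets.\<close>

lemma finite_triangle_packings: "fin_sgraph V E \<Longrightarrow> finite {P. triangle_packing V E P}"
  by (rule finite_subset[of _ "Pow ([V]\<^bsup>3\<^esup>)"])
    (auto simp: triangle_packing_def triangles_def fin_sgraph_def finite_imp_finite_nsets)

lemma triangle_packing_empty: "triangle_packing V E {}"
  by (simp add: triangle_packing_def)

lemma finite_triangle_hittings: "fin_sgraph V E \<Longrightarrow> finite {H. triangle_hitting V E H}"
  by (rule finite_subset[of _ "Pow ([V]\<^bsup>2\<^esup>)"])
    (auto simp: triangle_hitting_def fin_sgraph_def finite_imp_finite_nsets)

lemma triangle_hitting_all_edges: "triangle_hitting V E E"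
proof -
  have "E \<inter> [T]\<^bsup>2\<^esup> \<noteq> {}" if "T \<in> triangles V E" for T
  proof -
    from that have "card T = 3" and cl: "clique T E"
      by (auto simp: triangles_def nsets_def)
    then obtain x y z where "T = {x, y, z}" "x \<noteq> y"
      by (auto simp: card_3_iff)
    with cl have "{x, y} \<in> E \<inter> [T]\<^bsup>2\<^esup>"
      by (auto simp: clique_def)
    then show ?thesis by blast
  qed
  then show ?thesis by (simp add: triangle_hitting_def)
qed

text \<open>\<open>K\<close> is enumerated as \<open>c 1, \<dots>, c k\<close> and \<open>S\<close> as \<open>u 1, \<dots>, u s\<close>; either part may be empty.\<close>

definition threshold_graph :: "'a set \<Rightarrow> 'a set set \<Rightarrow> bool" where
  "threshold_graph V E \<longleftrightarrow> fin_sgraph V E \<and>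
     (\<exists>K S (c :: nat \<Rightarrow> 'a) (u :: nat \<Rightarrow> 'a) k s.
        K \<union> S = V \<and> K \<inter> S = {} \<and>
        bij_betw c {1..k} K \<and> bij_betw u {1..s} S \<and>
        clique K E \<and> indep S E \<and>
        (\<forall>i. 1 \<le> i \<and> i < k \<longrightarrow>
           closed_neighbourhood E (c (i + 1)) \<subseteq> closed_neighbourhood E (c i)) \<and>
        (\<forall>i. 1 \<le> i \<and> i < s \<longrightarrow>
           neighbourhood E (u i) \<subseteq> neighbourhood E (u (i + 1))))"

end

theory Submission
  imports Defs "HOL-Number_Theory.Cong"
begin

text \<open>Label the vertices by residues modulo \<open>n\<close>. Triangles that share an edge and have the same
  label sum also agree in the label of the third vertex, so under mild injectivity assumptions the
  triangles split into \<open>n\<close> packings; hence a graph on \<open>n\<close> vertices with \<open>N\<close> triangles has \<open>\<mu> \<ge> N / n\<close>.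

  Let the clique be \<open>c\<^sub>1, \<dots>, c\<^sub>k\<close>, let \<open>v \<in> S\<close> have neighbourhood \<open>c\<^sub>1, \<dots>, c\<^bsub>d v\<^esub>\<close>, and fix \<open>T \<le> k\<close>, \<open>r = k - T\<close>.
  Deleting the edges inside \<open>A = {c\<^sub>1, \<dots>, c\<^sub>T}\<close>, those inside the rest \<open>B\<close> of the clique, and those
  between \<open>B\<close> and \<open>S\<close> hits all triangles. Take the least \<open>T\<close> for which the number \<open>s\<close> of \<open>v \<in> S\<close> with
  \<open>d v > T\<close> satisfies \<open>s + k \<le> 2 T + 1\<close>, i.e. \<open>s + r \<le> T + 1\<close>. By minimality at least \<open>T\<close> vertices
  outside \<open>A\<close> are complete to \<open>A\<close>, so each edge of \<open>A\<close> can be given its own triangle. If \<open>s + r \<le> T\<close>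
  these \<open>T (T - 1) / 2\<close> triangles suffice. If \<open>s + r = T + 1\<close>, the bound \<open>N / n\<close> for the clique
  together with the \<open>s\<close> vertices of degree above \<open>T\<close> suffices, where \<open>n = k + s = 2 T + 1\<close>.\<close>

section \<open>Packings from label sums\<close>

lemma card_le_packing_number:
  assumes "fin_sgraph V E" "triangle_packing V E P"
  shows "card P \<le> packing_number V E"
  unfolding packing_number_def
  by (rule Max_ge) (use assms finite_triangle_packings in auto)

lemma hitting_number_le_card:
  assumes "fin_sgraph V E" "triangle_hitting V E H"
  shows "hitting_number V E \<le> card H"
  unfolding hitting_number_def
  by (rule Min_le) (use assms finite_triangle_hittings in auto)

lemma finite_triangles: "finite V \<Longrightarrow> finite (triangles V E)"
  unfolding triangles_def by (simp add: finite_imp_finite_nsets)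

lemma card_3_superset_doubletonE:
  assumes "card t = 3" "{x, y} \<subseteq> t" "x \<noteq> y"
  obtains z where "t = {x, y, z}" "z \<noteq> x" "z \<noteq> y"
proof -
  have "finite t" using assms(1) by (simp add: card_ge_0_finite)
  then have "card (t - {x, y}) = 1"
    using assms by (simp add: card_Diff_subset)
  then obtain z where "t - {x, y} = {z}" by (auto simp: card_1_singleton_iff)
  then have "t = {x, y, z}" "z \<noteq> x" "z \<noteq> y" using assms(2) by auto
  then show ?thesis by (rule that)
qed

text \<open>Each residue class of label sums is a packing, and there are \<open>n\<close> classes.
  The hypothesis on \<open>inj_on\<close> is deliberately local: only third vertices completing the
  same pair need distinct labels, so a labelling may repeat values elsewhere.\<close>

lemma card_le_packing_number_by_labels:
  fixes f :: "'a \<Rightarrow> nat"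
  assumes G: "fin_sgraph V E" and sub: "\<T> \<subseteq> triangles V E"
    and f_less: "\<And>t x. t \<in> \<T> \<Longrightarrow> x \<in> t \<Longrightarrow> f x < n"
    and inj: "\<And>x y. inj_on f {z. {x, y, z} \<in> \<T>}"
  shows "card \<T> \<le> n * packing_number V E"
proof -
  define P where "P r = {t \<in> \<T>. sum f t mod n = r}" for r
  have fin: "finite \<T>"
    using sub finite_triangles G finite_subset unfolding fin_sgraph_def by metis
  have T3: "card t = 3" if "t \<in> \<T>" for t
    using that sub by (auto simp: triangles_def nsets_def)
  have packing: "triangle_packing V E (P r)" for r
    unfolding triangle_packing_def
  proof (intro conjI pairwiseI)
    show "P r \<subseteq> triangles V E" using sub by (auto simp: P_def)
  next
    fix t t' assume t: "t \<in> P r" and t': "t' \<in> P r" and "t \<noteq> t'"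
    show "disjnt ([t]\<^bsup>2\<^esup>) ([t']\<^bsup>2\<^esup>)"
    proof (rule ccontr)
      assume "\<not> disjnt ([t]\<^bsup>2\<^esup>) ([t']\<^bsup>2\<^esup>)"
      then obtain e where e: "e \<in> [t]\<^bsup>2\<^esup>" "e \<in> [t']\<^bsup>2\<^esup>"
        by (auto simp: disjnt_def)
      then obtain x y where "e = {x, y}" "x \<noteq> y" by (auto elim: nsets2_E)
      with e have xy: "{x, y} \<subseteq> t" "{x, y} \<subseteq> t'" by auto
      have T: "t \<in> \<T>" "t' \<in> \<T>" using t t' by (auto simp: P_def)
      obtain z where z: "t = {x, y, z}" "z \<noteq> x" "z \<noteq> y"
        using card_3_superset_doubletonE[OF T3[OF T(1)] xy(1) \<open>x \<noteq> y\<close>] .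
      obtain z' where z': "t' = {x, y, z'}" "z' \<noteq> x" "z' \<noteq> y"
        using card_3_superset_doubletonE[OF T3[OF T(2)] xy(2) \<open>x \<noteq> y\<close>] .
      have "(f x + f y + f z) mod n = (f x + f y + f z') mod n"
        using t t' z z' \<open>x \<noteq> y\<close> by (simp add: P_def add.assoc)
      then have "f z mod n = f z' mod n"
        by (simp add: cong_add_lcancel_nat flip: cong_def)
      moreover have "f z < n" "f z' < n" using f_less T z z' by auto
      ultimately have "f z = f z'" by simp
      with inj[of x y] T z z' have "z = z'" by (auto dest: inj_onD)
      with z z' \<open>t \<noteq> t'\<close> show False by simp
    qed
  qed
  have "t \<in> (\<Union>r\<in>{..<n}. P r)" if "t \<in> \<T>" for t
  proof -
    \<comment> \<open>A vertex of \<open>t\<close> has a label below \<open>n\<close>, which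
      excludes \<open>n = 0\<close>; only then is \<open>sum f t mod n\<close> a valid index below
      \<open>n\<close>.\<close>
    have "t \<noteq> {}" using T3[OF that] by auto
    then have "n > 0" using f_less[OF that] by fastforce
    with that show ?thesis by (auto simp: P_def)
  qed
  then have "\<T> = (\<Union>r\<in>{..<n}. P r)" by (auto simp: P_def)
  then have "card \<T> \<le> (\<Sum>r<n. card (P r))"
    using card_UN_le[of "{..<n}" P] by simp
  also have "\<dots> \<le> (\<Sum>r<n. packing_number V E)"
    by (intro sum_mono card_le_packing_number[OF G packing])
  finally show ?thesis by simp
qed

text \<open>Any injective labelling of \<open>U\<close> serves. Allowing \<open>U\<close> to be
  smaller than \<open>V\<close> matters: discarding vertices in few triangles improves the
  quotient.\<close>

lemma card_triangles_le_packing_number: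
  assumes G: "fin_sgraph V E" and "U \<subseteq> V"
  shows "card (triangles U E) \<le> card U * packing_number V E"
proof -
  have "finite U" using assms finite_subset by (auto simp: fin_sgraph_def)
  then obtain f where f: "bij_betw f U {0..<card U}"
    using ex_bij_betw_finite_nat by blast
  show ?thesis
  proof (rule card_le_packing_number_by_labels[OF G])
    show "triangles U E \<subseteq> triangles V E"
      using nsets_mono[OF \<open>U \<subseteq> V\<close>] by (auto simp: triangles_def)
    show "f x < card U" if "t \<in> triangles U E" "x \<in> t" for t x
    proof -
      have "f x \<in> {0..<card U}"
        using that bij_betwE[OF f] by (auto simp: triangles_def nsets_def)
      then show ?thesis by simp
    qed
    show "inj_on f {z. {x, y, z} \<in> triangles U E}" for x y
      by (rule inj_on_subset[of f U])
        (use f in \<open>auto simp: triangles_def nsets_def bij_betw_def\<close>)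
  qed
qed

section \<open>Packings with one triangle per edge of a clique\<close>

lemma inj_on_insert_nsets:
  assumes "A \<inter> W = {}"
  shows "inj_on (\<lambda>(e, w). insert w e) ([A]\<^bsup>m\<^esup> \<times> W)"
proof (rule inj_onI, clarsimp)
  fix e w e' w'
  assume *: "e \<in> [A]\<^bsup>m\<^esup>" "w \<in> W" "e' \<in> [A]\<^bsup>m\<^esup>" "w' \<in> W" and eq: "insert w e = insert w' e'"
  then have "w \<notin> e" "w \<notin> e'" "w' \<notin> e" using assms by (auto simp: nsets_def)
  with eq have "w = w'" by (metis insertE insertI1)
  with eq \<open>w \<notin> e\<close> \<open>w \<notin> e'\<close> show "e = e' \<and> w = w'" by (simp add: insert_ident)
qed

lemma insert_mem_triangles:
  assumes "clique A E" "w \<notin> A" "e \<in> [A]\<^bsup>2\<^esup>" "A \<subseteq> V" "w \<in> V" "\<And>x. x \<in> e \<Longrightarrow> {w, x} \<in> E"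
  shows "insert w e \<in> triangles V E"
proof -
  obtain x y where e: "e = {x, y}" "x \<in> A" "y \<in> A" "x \<noteq> y"
    using assms(3) by (rule nsets2_E)
  then have "w \<noteq> x" "w \<noteq> y" using assms(2) by auto
  with e have "card (insert w e) = 3" by simp
  moreover have "{w, x} \<in> E" "{w, y} \<in> E" "{x, y} \<in> E"
    using assms(1,6) e by (auto simp: clique_def)
  then have "clique (insert w e) E"
    unfolding clique_def e(1) by (simp add: insert_commute)
  ultimately show ?thesis
    using assms(4,5) e by (auto simp: triangles_def nsets_def)
qed

text \<open>Labelling both \<open>A\<close> and \<open>card A\<close> of the vertices of \<open>W\<close> by the residues modulo \<open>card A\<close>
  properly colours the edges of the clique \<open>A\<close> by vertices of \<open>W\<close>.\<close>

lemma choose_two_le_packing_number: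
  assumes G: "fin_sgraph V E" and "A \<subseteq> V" "W \<subseteq> V" and disj: "A \<inter> W = {}"
    and cl: "clique A E" and full: "\<And>x w. x \<in> A \<Longrightarrow> w \<in> W \<Longrightarrow> {w, x} \<in> E"
    and le: "card A \<le> card W"
  shows "card A choose 2 \<le> packing_number V E"
proof (cases "card A = 0")
  case True
  then show ?thesis by (simp add: binomial_eq_0)
next
  case False
  obtain W' where W': "W' \<subseteq> W" "card W' = card A" "finite W'"
    using obtain_subset_with_card_n[OF le] by metis
  have "finite A" using False by (simp add: card_ge_0_finite)
  then obtain g where g: "bij_betw g A {0..<card A}"
    using ex_bij_betw_finite_nat by blast
  obtain h where h: "bij_betw h W' {0..<card A}"
    using ex_bij_betw_finite_nat[OF W'(3)] W'(2) by metis
  define f where "f x = (if x \<in> A then g x else h x)" for x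
  have disj': "A \<inter> W' = {}" using disj W'(1) by auto
  have fA: "f x = g x" if "x \<in> A" for x using that by (simp add: f_def)
  have fW: "f x = h x" if "x \<in> W'" for x using that disj' by (auto simp: f_def)
  have injA: "inj_on f A"
    using inj_on_cong[of A f g, OF fA] bij_betw_imp_inj_on[OF g] by blast
  have injW: "inj_on f W'"
    using inj_on_cong[of W' f h, OF fW] bij_betw_imp_inj_on[OF h] by blast
  \<comment> \<open>Edge of \<open>A\<close> plus apex in \<open>W'\<close>: there are
    \<open>card A\<close> times \<open>card A choose 2\<close> such triangles, so dividing by the
    \<open>card A\<close> labels leaves exactly the claimed bound.\<close>
  define \<T> where "\<T> = (\<lambda>(e, w). insert w e) ` ([A]\<^bsup>2\<^esup> \<times> W')"
  have count: "card \<T> = (card A choose 2) * card A"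
    unfolding \<T>_def card_image[OF inj_on_insert_nsets[OF disj']]
    by (simp add: card_cartesian_product W'(2))
  have split: "t \<subseteq> A \<union> W' \<and> card (t \<inter> A) = 2 \<and> card (t \<inter> W') = 1" if t: "t \<in> \<T>" for t
  proof -
    obtain e w where t: "t = insert w e" "e \<in> [A]\<^bsup>2\<^esup>" "w \<in> W'"
      using t by (auto simp: \<T>_def)
    then have "t \<inter> A = e" and W: "t \<inter> W' = {w}" using disj' by (auto simp: nsets_def)
    with t show ?thesis unfolding W by (auto simp: nsets_def)
  qed
  have "card \<T> \<le> card A * packing_number V E"
  proof (rule card_le_packing_number_by_labels[OF G])
    show "\<T> \<subseteq> triangles V E"
    proof
      fix t assume "t \<in> \<T>"
      then obtain e w where t: "t = insert w e" "e \<in> [A]\<^bsup>2\<^esup>" "w \<in> W'"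
        by (auto simp: \<T>_def)
      then have "{w, x} \<in> E" if "x \<in> e" for x
        using that full W'(1) by (auto simp: nsets_def)
      moreover have "w \<notin> A" "w \<in> V" using t(3) disj' W'(1) assms(3) by auto
      ultimately show "t \<in> triangles V E"
        using insert_mem_triangles[OF cl] t \<open>A \<subseteq> V\<close> by metis
    qed
    show "f x < card A" if "t \<in> \<T>" "x \<in> t" for t x
    proof -
      have "x \<in> A \<or> x \<in> W'" using split[OF that(1)] that(2) by auto
      then have "f x \<in> {0..<card A}"
        using fA fW bij_betwE[OF g] bij_betwE[OF h] by auto
      then show ?thesis by simp
    qed
    show "inj_on f {z. {x, y, z} \<in> \<T>}" for x y
    proof (rule inj_onI)
      fix z z' assume z: "z \<in> {z. {x, y, z} \<in> \<T>}" and z': "z' \<in> {z. {x, y, z} \<in> \<T>}"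
        and eq: "f z = f z'"
      have s: "{x, y, z} \<subseteq> A \<union> W'" "card ({x, y, z} \<inter> A) = 2" "card ({x, y, z} \<inter> W') = 1"
        and s': "{x, y, z'} \<subseteq> A \<union> W'" "card ({x, y, z'} \<inter> A) = 2" "card ({x, y, z'} \<inter> W') = 1"
        using split z z' by blast+
      \<comment> \<open>Every label occurs once in \<open>A\<close> and once in \<open>W'\<close>,
        so \<open>f\<close> separates only vertices on the same side. The pair \<open>x\<close>,
        \<open>y\<close> decides the side of the third vertex.\<close>
      have "z \<in> A \<and> z' \<in> A \<or> z \<in> W' \<and> z' \<in> W'"
      proof (cases "x \<in> A \<and> y \<in> A")
        case True
        then have "z \<notin> A" if "z \<in> A \<union> W'" "card ({x, y, z} \<inter> W') = 1" for z
          using that disj' by (auto simp: card_1_singleton_iff)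
        with True s s' show ?thesis by auto
      next
        case False
        then have "x \<in> W' \<or> y \<in> W'" using s by auto
        then have inA: "z \<in> A" if z: "{x, y, z} \<subseteq> A \<union> W'"
          and oneW: "card ({x, y, z} \<inter> W') = 1" and twoA: "card ({x, y, z} \<inter> A) = 2" for z
        proof -
          obtain w where w: "{x, y, z} \<inter> W' = {w}" using oneW by (auto simp: card_1_singleton_iff)
          show ?thesis
          proof (rule ccontr)
            assume "z \<notin> A"
            then have "z \<in> W'" using z by auto
            \<comment> \<open>Whichever of \<open>x\<close>, \<open>y\<close> lies in
              \<open>W'\<close> is also \<open>w\<close>, so the triple would have at most one
              element in \<open>A\<close>.\<close>
            then have "z = w" using w by auto
            then have "{x, y, z} \<inter> A \<subseteq> {x} \<or> {x, y, z} \<inter> A \<subseteq> {y}"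
              using \<open>x \<in> W' \<or> y \<in> W'\<close> \<open>z \<notin> A\<close> disj' by auto
            then have "card ({x, y, z} \<inter> A) \<le> 1"
              by (metis card_mono finite.emptyI finite.insertI is_singletonI is_singleton_altdef)
            with twoA show False by simp
          qed
        qed
        show ?thesis using inA[OF s(1,3,2)] inA[OF s'(1,3,2)] by blast
      qed
      then show "z = z'" using eq injA injW by (auto dest: inj_onD)
    qed
  qed
  then show ?thesis using False count by simp
qed

text \<open>Counts the triples inside \<open>C\<close> and the triangles with a single vertex
  \<open>w\<close> in \<open>W\<close>. The trace of a triangle on \<open>W\<close> tells these
  families apart, so their sizes add.\<close>

lemma card_triangles_ge:
  assumes "finite C" "finite W" and disj: "C \<inter> W = {}" and cl: "clique C E"
  shows "(card C choose 3) + (\<Sum>w\<in>W. card (neighbourhood E w \<inter> C) choose 2)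
    \<le> card (triangles (C \<union> W) E)"
proof -
  define N where "N w = neighbourhood E w \<inter> C" for w
  define X where "X = (\<Union>w\<in>W. insert w ` ([N w]\<^bsup>2\<^esup>))"
  have fin: "finite ([N w]\<^bsup>2\<^esup>)" for w
    using assms(1) by (simp add: N_def finite_imp_finite_nsets)
  have avoid: "e \<inter> W = {}" if "e \<in> [N w]\<^bsup>2\<^esup>" for e w
    using that disj by (auto simp: nsets_def N_def)
  have "card (insert w ` ([N w]\<^bsup>2\<^esup>)) = card (N w) choose 2" if "w \<in> W" for w
  proof -
    have "inj_on (insert w) ([N w]\<^bsup>2\<^esup>)"
    proof (rule inj_onI)
      fix e e' assume "e \<in> [N w]\<^bsup>2\<^esup>" "e' \<in> [N w]\<^bsup>2\<^esup>" and eq: "insert w e = insert w e'"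
      then have "w \<notin> e" "w \<notin> e'" using avoid that by auto
      with eq show "e = e'" by (simp add: insert_ident)
    qed
    then show ?thesis by (simp add: card_image)
  qed
  moreover have "insert w ` ([N w]\<^bsup>2\<^esup>) \<inter> insert w' ` ([N w']\<^bsup>2\<^esup>) = {}"
    if "w \<in> W" "w' \<in> W" "w \<noteq> w'" for w w'
    using that avoid by blast
  ultimately have X: "card X = (\<Sum>w\<in>W. card (N w) choose 2)"
    unfolding X_def using assms(2) fin by (subst card_UN_disjoint) auto
  have "[C]\<^bsup>3\<^esup> \<inter> X = {}" using disj by (auto simp: X_def nsets_def)
  moreover have "finite X" using assms(2) fin by (auto simp: X_def)
  ultimately have "card ([C]\<^bsup>3\<^esup> \<union> X) = (card C choose 3) + card X"
    using assms(1) by (simp add: card_Un_disjoint finite_imp_finite_nsets)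
  moreover have "[C]\<^bsup>3\<^esup> \<union> X \<subseteq> triangles (C \<union> W) E"
  proof -
    have "insert w e \<in> triangles (C \<union> W) E" if "w \<in> W" "e \<in> [N w]\<^bsup>2\<^esup>" for w e
      by (rule insert_mem_triangles[OF cl])
        (use that disj in \<open>auto simp: N_def nsets_def neighbourhood_def\<close>)
    moreover have "[C]\<^bsup>3\<^esup> \<subseteq> triangles (C \<union> W) E"
      using cl by (auto simp: triangles_def nsets_def clique_def)
    ultimately show ?thesis by (auto simp: X_def)
  qed
  ultimately show ?thesis
    using X card_mono[OF finite_triangles[of "C \<union> W"]] assms(1,2) unfolding N_def
    by (metis finite_UnI)
qed

section \<open>Hitting sets of split graphs\<close>

text \<open>A triangle has at most one vertex in the independent set \<open>S\<close>. Hence it has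
  two vertices in \<open>A\<close>, or two in \<open>B\<close>, or one in each of \<open>A\<close>,
  \<open>B\<close>, \<open>S\<close>; the last kind contains an edge between \<open>B\<close> and
  \<open>S\<close>.\<close>

lemma hitting_number_le_split:
  assumes G: "fin_sgraph V E" and V: "V = A \<union> B \<union> S"
    and disj: "A \<inter> B = {}" "A \<inter> S = {}" "B \<inter> S = {}"
    and cl: "clique A E" "clique B E" and ind: "indep S E"
  shows "hitting_number V E \<le>
    (card A choose 2) + (card B choose 2) + (\<Sum>v\<in>S. card (neighbourhood E v \<inter> B))"
proof -
  have fin: "finite A" "finite B" "finite S" using G V by (auto simp: fin_sgraph_def)
  define X where "X = (\<Union>v\<in>S. (\<lambda>b. {v, b}) ` (neighbourhood E v \<inter> B))"
  define H where "H = [A]\<^bsup>2\<^esup> \<union> [B]\<^bsup>2\<^esup> \<union> X"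
  have "card X \<le> (\<Sum>v\<in>S. card ((\<lambda>b. {v, b}) ` (neighbourhood E v \<inter> B)))"
    unfolding X_def by (rule card_UN_le[OF fin(3)])
  also have "\<dots> \<le> (\<Sum>v\<in>S. card (neighbourhood E v \<inter> B))"
    by (intro sum_mono card_image_le) (use fin in auto)
  finally have "card H \<le>
      (card A choose 2) + (card B choose 2) + (\<Sum>v\<in>S. card (neighbourhood E v \<inter> B))"
    unfolding H_def
    using card_Un_le[of "[A]\<^bsup>2\<^esup> \<union> [B]\<^bsup>2\<^esup>" X] card_Un_le[of "[A]\<^bsup>2\<^esup>" "[B]\<^bsup>2\<^esup>"] by simp
  moreover have "triangle_hitting V E H"
    unfolding triangle_hitting_def
  proof (intro conjI ballI)
    show "H \<subseteq> E"
      using cl by (auto simp: H_def X_def nsets_2_eq clique_def neighbourhood_def)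
  next
    fix t assume "t \<in> triangles V E"
    then have t: "t \<subseteq> V" "finite t" "card t = 3" "clique t E"
      by (auto simp: triangles_def nsets_def)
    have pair: "[C]\<^bsup>2\<^esup> \<inter> [t]\<^bsup>2\<^esup> \<noteq> {}" if two: "2 \<le> card (t \<inter> C)" for C
    proof -
      obtain e where "e \<subseteq> t \<inter> C" "card e = 2"
        using obtain_subset_with_card_n[OF two] by metis
      moreover have "finite e" using \<open>card e = 2\<close> card.infinite by fastforce
      ultimately have "e \<in> [C]\<^bsup>2\<^esup>" "e \<in> [t]\<^bsup>2\<^esup>" by (auto simp: nsets_def)
      then show ?thesis by blast
    qed
    have "card (t \<inter> S) \<le> 1"
    proof (rule ccontr)
      assume "\<not> card (t \<inter> S) \<le> 1"
      then have "[S]\<^bsup>2\<^esup> \<inter> [t]\<^bsup>2\<^esup> \<noteq> {}" by (intro pair) simp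
      then obtain x y where "x \<in> S" "y \<in> S" "x \<noteq> y" "x \<in> t" "y \<in> t"
        by (auto simp: nsets_2_eq doubleton_eq_iff)
      with t(4) ind show False by (auto simp: clique_def indep_def)
    qed
    moreover have "card t = card (t \<inter> A) + card (t \<inter> B) + card (t \<inter> S)"
    proof -
      have "t = (t \<inter> A) \<union> (t \<inter> B) \<union> (t \<inter> S)" using t(1) V by auto
      then have "card t = card ((t \<inter> A) \<union> (t \<inter> B) \<union> (t \<inter> S))" by simp
      also have "\<dots> = card ((t \<inter> A) \<union> (t \<inter> B)) + card (t \<inter> S)"
        by (rule card_Un_disjoint) (use t disj in auto)
      also have "card ((t \<inter> A) \<union> (t \<inter> B)) = card (t \<inter> A) + card (t \<inter> B)"
        by (rule card_Un_disjoint) (use t disj in auto)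
      finally show ?thesis .
    qed
    ultimately consider "card (t \<inter> A) \<ge> 2" | "card (t \<inter> B) \<ge> 2"
      | "card (t \<inter> B) = 1" "card (t \<inter> S) = 1" using t(3) by linarith
    then show "H \<inter> [t]\<^bsup>2\<^esup> \<noteq> {}"
    proof cases
      case 1
      then show ?thesis using pair[of A] by (auto simp: H_def)
    next
      case 2
      then show ?thesis using pair[of B] by (auto simp: H_def)
    next
      case 3
      then obtain b v where "t \<inter> B = {b}" "t \<inter> S = {v}" by (auto simp: card_1_singleton_iff)
      then have bv: "b \<in> t" "b \<in> B" "v \<in> t" "v \<in> S" "v \<noteq> b" using disj by auto
      then have "{v, b} \<in> X"
        using t(4) by (auto simp: X_def neighbourhood_def clique_def)
      moreover have "{v, b} \<in> [t]\<^bsup>2\<^esup>" using bv by simp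
      ultimately show ?thesis by (auto simp: H_def)
    qed
  qed
  ultimately show ?thesis using hitting_number_le_card[OF G] le_trans by blast
qed

section \<open>Threshold graphs\<close>

lemma two_choose_two: "2 * int (n choose 2) = int n * (int n - 1)"
proof -
  have "2 * (n choose 2) = n * (n - 1)"
    by (cases n) (simp_all add: choose_two)
  then have "2 * int (n choose 2) = int n * int (n - 1)"
    by (metis of_nat_mult of_nat_numeral)
  then show ?thesis by (cases n) simp_all
qed

lemma six_choose_three: "6 * int (n choose 3) = int n * (int n - 1) * (int n - 2)"
proof (induction n)
  case 0
  then show ?case by (simp add: numeral_3_eq_3)
next
  case (Suc n)
  have "Suc n choose 3 = (n choose 2) + (n choose 3)"
    by (simp add: numeral_3_eq_3 numeral_2_eq_2)
  with Suc two_choose_two[of n] show ?case by (simp add: algebra_simps)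
qed

text \<open>With \<open>T = s + r + m\<close>, twice the difference of the two sides is
  \<open>s (s - 1) + 2 m (s + r) + m (m - 1)\<close>. This bounds the deleted edges outside
  \<open>A\<close> by the number of edges in \<open>A\<close>.\<close>

lemma fill_inequality:
  fixes T r s :: nat
  assumes "s + r \<le> T"
  shows "(r choose 2) + s * r \<le> T choose 2"
proof -
  obtain m where T: "T = s + r + m" using assms le_Suc_ex by blast
  have "int m * (2 * int s + 2 * int r) + int m * (int m - 1) \<ge> 0"
    by (cases m) (auto intro!: add_nonneg_nonneg)
  moreover have "int s * (int s - 1) \<ge> 0" by (cases s) auto
  moreover have "2 * int (T choose 2) - 2 * int (r choose 2) - 2 * (int s * int r)
    = int s * (int s - 1) + (int m * (2 * int s + 2 * int r) + int m * (int m - 1))"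
    unfolding two_choose_two T by (simp add: algebra_simps)
  ultimately have "0 \<le> 2 * int (T choose 2) - 2 * int (r choose 2) - 2 * (int s * int r)"
    by (simp only: add_nonneg_nonneg)
  then have "2 * int ((r choose 2) + s * r) \<le> 2 * int (T choose 2)" by simp
  then show ?thesis by (simp only: mult_le_cancel_left_pos zero_less_numeral of_nat_le_iff)
qed

text \<open>The parameters are \<open>a = s\<close> and \<open>p = r - 1\<close> in the case
  \<open>s + r = T + 1\<close>. The difference of the sides is a sum of nonnegative terms plus 6;
  the slack \<open>6 * (2 * T + 1)\<close> becomes a single unit after division and is absorbed by
  integrality.\<close>

lemma count_inequality:
  fixes a p :: int
  assumes "a \<ge> 0" "p \<ge> 0"
  defines "T \<equiv> p + a" and "k \<equiv> 2 * p + a + 1"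
  shows "3 * (2 * T + 1) * (T * (T - 1) + (p + 1) * p)
    < 2 * k * (k - 1) * (k - 2) + 6 * a * (T * (T - 1) - 1) + 6 * (2 * T + 1)"
proof -
  have "2 * k * (k - 1) * (k - 2) + 6 * a * (T * (T - 1) - 1) + 6 * (2 * T + 1)
      - 3 * (2 * T + 1) * (T * (T - 1) + (p + 1) * p)
    = p * (3 * (p - 1)\<^sup>2 + p\<^sup>2 + 5) + a * ((a - 1)\<^sup>2 + (a\<^sup>2 - a) + 6) + 6 * a * (p\<^sup>2 - p) + 6 * a\<^sup>2 * p + 6"
    unfolding T_def k_def by (simp add: algebra_simps power2_eq_square)
  moreover have sq: "x\<^sup>2 - x \<ge> 0" if "x \<ge> 0" for x :: int
    using that by (cases "x = 0") (auto simp: power2_eq_square mult_le_cancel_left1)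
  moreover have "p * (3 * (p - 1)\<^sup>2 + p\<^sup>2 + 5) \<ge> 0" using assms(2) by simp
  moreover have "a * ((a - 1)\<^sup>2 + (a\<^sup>2 - a) + 6) \<ge> 0"
    using assms(1) sq[of a] by simp
  moreover have "6 * a * (p\<^sup>2 - p) \<ge> 0" "6 * a\<^sup>2 * p \<ge> 0"
    using assms(1,2) sq[of p] by auto
  ultimately show ?thesis by linarith
qed

section \<open>Initial segments as neighbourhoods and the two cases\<close>

lemma initial_segment:
  assumes "I \<subseteq> {1..k}" and "\<And>i. 1 \<le> i \<Longrightarrow> Suc i \<in> I \<Longrightarrow> i \<in> I"
  shows "\<exists>d\<le>k. I = {1..d::nat}"
  using assms(1)
proof (induction k)
  case 0
  then show ?case by auto
next
  case (Suc k)
  show ?case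
  proof (cases "Suc k \<in> I")
    case True
    have "i \<in> I" if "i \<le> Suc k" "1 \<le> i" for i
      using that
    proof (induction rule: inc_induct)
      case base
      then show ?case using True by simp
    next
      case (step i)
      show ?case by (rule assms(2)[OF step.prems step.IH]) simp
    qed
    then have "I = {1..Suc k}" using Suc.prems by auto
    then show ?thesis by auto
  next
    case False
    then have "I \<subseteq> {1..k}" using Suc.prems by (auto simp: atLeastAtMostSuc_conv)
    then show ?thesis using Suc.IH le_SucI by blast
  qed
qed

text \<open>Encoding each neighbourhood by its length \<open>d v\<close> reduces the threshold
  structure to numbers: cutting the clique at \<open>T\<close> leaves \<open>v\<close> with
  \<open>d v - T\<close> neighbours beyond the cut.\<close>

lemma hitting_number_le_packing_number_nested:
  fixes c :: "nat \<Rightarrow> 'a" and d :: "'a \<Rightarrow> nat"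
  assumes G: "fin_sgraph V E" and V: "V = c ` {1..k} \<union> S" and disj: "c ` {1..k} \<inter> S = {}"
    and inj: "inj_on c {1..k}" and cl: "clique (c ` {1..k}) E" and ind: "indep S E"
    and d_le: "\<And>v. v \<in> S \<Longrightarrow> d v \<le> k"
    and nbhd: "\<And>v. v \<in> S \<Longrightarrow> neighbourhood E v = c ` {1..d v}"
  shows "hitting_number V E \<le> 2 * packing_number V E"
proof -
  define above where "above t = {v \<in> S. t < d v}" for t
  define T where "T = (LEAST t. card (above t) + k \<le> 2 * t + 1)"
  define A where "A = c ` {1..T}"
  define B where "B = c ` {T<..k}"
  define r where "r = k - T"
  define s where "s = card (above T)"
  define X where "X = (\<Sum>v\<in>above T. d v - T)"
  have finS: "finite S" using G V by (auto simp: fin_sgraph_def)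
  then have fin: "finite (above t)" for t by (simp add: above_def)
  \<comment> \<open>So \<open>t = k\<close> satisfies the condition defining \<open>T\<close>; this
    makes the \<open>LEAST\<close> meaningful and gives \<open>T \<le> k\<close>.\<close>
  have "above k = {}" using d_le by (fastforce simp: above_def)
  then have top: "card (above k) + k \<le> 2 * k + 1" by simp
  have T: "s + k \<le> 2 * T + 1"
    unfolding s_def T_def using LeastI[of "\<lambda>t. card (above t) + k \<le> 2 * t + 1", OF top] .
  have "T \<le> k" unfolding T_def using Least_le[of "\<lambda>t. card (above t) + k \<le> 2 * t + 1", OF top] .
  then have k: "k = T + r" by (simp add: r_def)
  have K: "c ` {1..k} = A \<union> B"
    unfolding A_def B_def image_Un[symmetric] using \<open>T \<le> k\<close> by (intro arg_cong[of _ _ "(`) c"]) auto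
  have sub: "{1..T} \<subseteq> {1..k}" "{T<..k} \<subseteq> {1..k}" using \<open>T \<le> k\<close> by auto
  have cardA: "card A = T"
    unfolding A_def using card_image[OF inj_on_subset[OF inj sub(1)]] by simp
  have cardB: "card B = r"
    unfolding B_def r_def using card_image[OF inj_on_subset[OF inj sub(2)]] by simp
  have AB: "A \<inter> B = {}"
    unfolding A_def B_def using inj_on_image_Int[OF inj sub] by auto
  have disjS: "A \<inter> S = {}" "B \<inter> S = {}" using disj K by auto
  have clAB: "clique A E" "clique B E" using cl unfolding K clique_def by auto
  have nbhdB: "card (neighbourhood E v \<inter> B) = d v - T" if "v \<in> S" for v
  proof -
    have "{1..d v} \<subseteq> {1..k}" using d_le[OF that] by auto
    then have "neighbourhood E v \<inter> B = c ` ({1..d v} \<inter> {T<..k})"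
      unfolding nbhd[OF that] B_def using inj_on_image_Int[OF inj _ sub(2)] by metis
    also have "{1..d v} \<inter> {T<..k} = {T<..d v}" using d_le[OF that] by auto
    also have "card (c ` {T<..d v}) = d v - T"
      using d_le[OF that]
      by (subst card_image[OF inj_on_subset[OF inj]]) auto
    finally show ?thesis .
  qed
  have "hitting_number V E \<le>
      (card A choose 2) + (card B choose 2) + (\<Sum>v\<in>S. card (neighbourhood E v \<inter> B))"
    by (rule hitting_number_le_split[OF G _ AB disjS clAB ind]) (use V K in simp)
  \<comment> \<open>For \<open>d v \<le> T\<close> the truncated difference is 0, so only
    \<open>above T\<close> contributes.\<close>
  also have "(\<Sum>v\<in>S. card (neighbourhood E v \<inter> B)) = X"
    unfolding X_def using nbhdB finS
    by (intro sum.mono_neutral_cong_right) (auto simp: above_def)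
  finally have hit: "hitting_number V E \<le> (T choose 2) + (r choose 2) + X"
    unfolding cardA cardB .
  show ?thesis
  proof (cases "s + r \<le> T")
    case True
    have "X \<le> s * r"
      unfolding X_def s_def r_def
      by (rule sum_bounded_above[of _ _ "k - T", simplified]) (auto simp: above_def intro: diff_le_mono d_le)
    then have "(T choose 2) + (r choose 2) + X \<le> 2 * (T choose 2)"
      using fill_inequality[OF True] by linarith
    moreover have "T choose 2 \<le> packing_number V E"
    proof (cases T)
      case 0
      then show ?thesis by (simp add: binomial_eq_0)
    next
      case (Suc t)
      \<comment> \<open>Since \<open>T = t + 1\<close>, the vertices in \<open>above t\<close> have
        \<open>d v \<ge> T\<close> and are complete to \<open>A\<close>. Failure of the condition at
        \<open>t\<close> says \<open>card (above t) + k \<ge> 2 * T\<close>, that is,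
        \<open>card W \<ge> T\<close>.\<close>
      define W where "W = B \<union> above t"
      have "\<not> card (above t) + k \<le> 2 * t + 1"
        using not_less_Least[of t "\<lambda>t. card (above t) + k \<le> 2 * t + 1"] Suc unfolding T_def by simp
      moreover have "card W = r + card (above t)"
        unfolding W_def cardB[symmetric]
        by (rule card_Un_disjoint) (use fin disjS in \<open>auto simp: B_def above_def\<close>)
      ultimately have "card A \<le> card W" using cardA k Suc by linarith
      have "card A choose 2 \<le> packing_number V E"
      proof (rule choose_two_le_packing_number[OF G _ _ _ clAB(1) _ \<open>card A \<le> card W\<close>])
        show "A \<subseteq> V" "W \<subseteq> V" "A \<inter> W = {}"
          using V K AB disjS by (auto simp: W_def above_def)
        show "{w, x} \<in> E" if "x \<in> A" "w \<in> W" for x w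
          using that(2) unfolding W_def
        proof
          assume "w \<in> B"
          moreover from this have "w \<noteq> x" using that(1) AB by auto
          ultimately show ?thesis
            using cl that(1) unfolding K clique_def by (simp only: Un_iff simp_thms)
        next
          assume "w \<in> above t"
          then have "w \<in> S" "T \<le> d w" using Suc by (auto simp: above_def)
          then have "x \<in> neighbourhood E w"
            using that(1) by (auto simp: nbhd A_def)
          then show ?thesis by (simp add: neighbourhood_def)
        qed
      qed
      then show ?thesis by (simp add: cardA)
    qed
    ultimately show ?thesis using hit by linarith
  next
    case False
    then have T1: "s + r = T + 1" using T k by linarith
    have "r \<noteq> 0"
    proof
      assume "r = 0"
      then have "s = 0" using k \<open>above k = {}\<close> by (simp add: s_def)
      with \<open>r = 0\<close> T1 show False by simp
    qed
    then obtain p where p: "r = Suc p" using not0_implies_Suc by blast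
    \<comment> \<open>Its size is \<open>k + s = T + r + s = 2 * T + 1\<close>.\<close>
    define U where "U = c ` {1..k} \<union> above T"
    have disjU: "c ` {1..k} \<inter> above T = {}" using disj by (auto simp: above_def)
    have "card U = card (c ` {1..k}) + s"
      unfolding U_def s_def by (rule card_Un_disjoint) (use fin disjU in auto)
    then have cardU: "card U = 2 * T + 1" using card_image[OF inj] k T1 by simp
    have nbhd_card: "card (neighbourhood E v \<inter> c ` {1..k}) = d v" if "v \<in> S" for v
    proof -
      have "neighbourhood E v \<inter> c ` {1..k} = c ` {1..d v}"
        using nbhd[OF that] d_le[OF that] by auto
      then show ?thesis
        using card_image[OF inj_on_subset[OF inj, of "{1..d v}"]] d_le[OF that] by simp
    qed
    have "(k choose 3) + (\<Sum>v\<in>above T. d v choose 2)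
      = (card (c ` {1..k}) choose 3) +
        (\<Sum>v\<in>above T. card (neighbourhood E v \<inter> c ` {1..k}) choose 2)"
      using card_image[OF inj] nbhd_card by (auto simp: above_def intro!: sum.cong)
    also have "\<dots> \<le> card (triangles U E)"
      unfolding U_def by (rule card_triangles_ge[OF _ fin disjU cl]) simp
    also have "\<dots> \<le> (2 * T + 1) * packing_number V E"
      unfolding cardU[symmetric]
      by (rule card_triangles_le_packing_number[OF G]) (use V in \<open>auto simp: U_def above_def\<close>)
    \<comment> \<open>The factor 12 clears the denominators of the binomials and leaves
      \<open>2 * packing_number V E\<close> with the coefficient
      \<open>6 * (2 * T + 1)\<close>.\<close>
    finally have "12 * int ((k choose 3) + (\<Sum>v\<in>above T. d v choose 2))
      \<le> 12 * int ((2 * T + 1) * packing_number V E)"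
      by (metis mult_left_mono of_nat_mono zero_le_numeral)
    then have count: "2 * (6 * int (k choose 3)) + 6 * (\<Sum>v\<in>above T. 2 * int (d v choose 2))
      \<le> 12 * ((2 * int T + 1) * int (packing_number V E))"
      by (simp add: sum_distrib_left algebra_simps)
    \<comment> \<open>Linear lower bound for a convex function, tight at \<open>d v = T + 1\<close>.
      Its slope \<open>2 * T + 1\<close> equals \<open>card U\<close>, so after summation the term
      in \<open>X\<close> matches the one in the hitting bound.\<close>
    have "int T * (int T - 1) - 1 + (2 * int T + 1) * int (d v - T) \<le> 2 * int (d v choose 2)"
      if "v \<in> above T" for v
    proof -
      have e: "int (d v) = int T + int (d v - T)" using that by (simp add: above_def)
      have "2 * int (d v choose 2)
        = int T * (int T - 1) - 1 + (2 * int T + 1) * int (d v - T) + (int (d v - T) - 1)\<^sup>2"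
        unfolding two_choose_two e by (simp add: power2_eq_square algebra_simps)
      then show ?thesis by simp
    qed
    then have "(\<Sum>v\<in>above T. int T * (int T - 1) - 1 + (2 * int T + 1) * int (d v - T))
      \<le> (\<Sum>v\<in>above T. 2 * int (d v choose 2))"
      by (rule sum_mono)
    then have "int s * (int T * (int T - 1) - 1) + (2 * int T + 1) * int X
      \<le> (\<Sum>v\<in>above T. 2 * int (d v choose 2))"
      by (simp add: sum.distrib sum_distrib_left X_def s_def)
    moreover have "3 * (2 * int T + 1) * (int T * (int T - 1) + int r * (int r - 1))
      < 2 * int k * (int k - 1) * (int k - 2) + 6 * int s * (int T * (int T - 1) - 1)
        + 6 * (2 * int T + 1)"
    proof -
      have "int T = int p + int s" "int k = 2 * int p + int s + 1" "int r = int p + 1"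
        using T1 k p by simp_all
      then show ?thesis using count_inequality[of "int s" "int p"] by simp
    qed
    ultimately have "3 * (2 * int T + 1) * (int T * (int T - 1) + int r * (int r - 1))
        + 6 * ((2 * int T + 1) * int X)
      < 12 * ((2 * int T + 1) * int (packing_number V E)) + 6 * (2 * int T + 1)"
      using count unfolding six_choose_three by (simp add: algebra_simps)
    then have "(6 * (2 * int T + 1)) * (int (T choose 2) + int (r choose 2) + int X)
      < (6 * (2 * int T + 1)) * (2 * int (packing_number V E) + 1)"
      unfolding two_choose_two[symmetric] by (simp add: algebra_simps)
    then have "int (T choose 2) + int (r choose 2) + int X < 2 * int (packing_number V E) + 1"
      by (subst (asm) mult_less_cancel_left_pos) simp_all
    then show ?thesis using hit by linarith
  qed
qed

theorem theorem2:
  fixes V :: "'a set" and E :: "'a set set"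
  assumes "threshold_graph V E"
  shows "hitting_number V E \<le> 2 * packing_number V E"
proof -
  obtain K S and c :: "nat \<Rightarrow> 'a" and k where
    G: "fin_sgraph V E" and V: "K \<union> S = V" "K \<inter> S = {}" and c: "bij_betw c {1..k} K"
    and cl: "clique K E" and ind: "indep S E"
    and nested: "\<And>i. 1 \<le> i \<Longrightarrow> i < k \<Longrightarrow>
      closed_neighbourhood E (c (i + 1)) \<subseteq> closed_neighbourhood E (c i)"
    using assms unfolding threshold_graph_def by blast
  have K: "K = c ` {1..k}" using c by (simp add: bij_betw_def)
  have "\<exists>m\<le>k. neighbourhood E v = c ` {1..m}" if v: "v \<in> S" for v
  proof -
    define I where "I = {i \<in> {1..k}. {c i, v} \<in> E}"
    \<comment> \<open>Nesting concerns closed neighbourhoods; as \<open>v\<close> lies outside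
      \<open>K\<close>, membership in one centred at a clique vertex still means adjacency.\<close>
    have "i \<in> I" if "1 \<le> i" "Suc i \<in> I" for i
    proof -
      have i: "i < k" "{c (Suc i), v} \<in> E" using that(2) by (auto simp: I_def)
      then have "v \<in> closed_neighbourhood E (c i)"
        using nested[OF that(1) i(1)] by (auto simp: closed_neighbourhood_def neighbourhood_def)
      moreover have "c i \<in> K" using K that(1) i(1) by auto
      then have "v \<noteq> c i" using V(2) v by auto
      ultimately show ?thesis
        using that(1) i(1) by (auto simp: I_def closed_neighbourhood_def neighbourhood_def)
    qed
    then obtain m where m: "m \<le> k" "I = {1..m}"
      using initial_segment[of I k] unfolding I_def by blast
    have "neighbourhood E v \<subseteq> K"
    proof
      fix w assume "w \<in> neighbourhood E v"
      then have vw: "{v, w} \<in> E" by (simp add: neighbourhood_def)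
      \<comment> \<open>Edges have two distinct ends; \<open>indep\<close> constrains only distinct
        vertices, so \<open>w = v\<close> must be excluded separately.\<close>
      then have "{v, w} \<in> [V]\<^bsup>2\<^esup>" using G by (auto simp only: fin_sgraph_def)
      then have "w \<in> V" "v \<noteq> w" by auto
      then show "w \<in> K" using ind v vw V(1) by (auto simp: indep_def)
    qed
    then have "neighbourhood E v = c ` I"
      unfolding K I_def by (auto simp: neighbourhood_def insert_commute)
    with m show ?thesis by auto
  qed
  then obtain d where d: "\<And>v. v \<in> S \<Longrightarrow> d v \<le> k \<and> neighbourhood E v = c ` {1..d v}"
    by metis
  show ?thesis
    by (rule hitting_number_le_packing_number_nested[OF G, of c k S d])
      (use V c cl ind d in \<open>auto simp: K bij_betw_def\<close>)
qed

end
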